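(* Let $\mathcal{T}$ be a self-affine tiling of $\mathbb{R}^d$ with expansion map $Q$ and a primitive substitution rule $\omega$ with finite local complexity. Suppose $Q$ is diagonalizable over $\mathbb{C}$ and all eigenvalues of $Q$ are algebraic conjugates of one another, each with the same multiplicity $J$. If there exists an algebraic conjugate $\beta$ of the eigenvalues of $Q$ with $|\beta|<1$, then for every return vector $x\in\mathbb{R}^d\setminus\{0\}$ of $\mathcal{T}$ there is $n_0\in\mathbb{N}$ such that $T+nx\notin\mathcal{T}$ for all $n>n_0$ and all $T\in\mathcal{T}$. Consequently, for each $T\in\mathcal{T}$ and each such $x\neq 0$ there is $n_0>0$ such that $\bigcup_{k=1}^{n_0}(T+kx)$ is not $\mathcal{T}$-legal.
   Context: A tile in $\mathbb{R}^d$ is a compact set equal to the closure of its interior, possibly carrying a label from a fixed finite set; $T+x$ denotes the translate. A patch is a set of tiles any two distinct members of which have disjoint interiors; its support is the closure of the union of the supports. A tiling is a patch with support $\mathbb{R}^d$. A patch $\mathcal{P}$ is $\mathcal{T}$-legal if $\mathcal{P}+x\subset\mathcal{T}$ for some $x$. For a patch $\mathcal{P}$ and $S\subset\mathbb{R}^d$, $\mathcal{P}\sqcap S=\{T\in\mathcal{P}:\operatorname{supp}T\cap S\neq\emptyset\}$. A tiling $\mathcal{T}$ has finite local complexity (FLC) if for each compact $K$ the set $\{\mathcal{T}\sqcap(K+x):x\in\mathbb{R}^d\}$ is finite up to translation, and is repetitive if for every finite $\mathcal{T}$-legal patch $\mathcal{P}$ there is $R>0$ such that every ball of radius $R$ contains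 the support of some translate $\mathcal{P}+x\subset\mathcal{T}$. A return vector of $\mathcal{T}$ is an $x$ such that $T\in\mathcal{T}$ and $T+x\in\mathcal{T}$ for some tile $T$. A substitution rule consists of a finite set $\mathcal{A}$ of prototiles, a linear expansion map $Q$ (all eigenvalues of modulus $>1$), and a map $\omega$ assigning to each $P\in\mathcal{A}$ a finite patch of translates of prototiles with $\operatorname{supp}\omega(P)=Q(\operatorname{supp}P)$, extended by $\omega(P+x)=\omega(P)+Qx$ and unions. It is primitive if some power of its substitution matrix (entry $(i,j)$ = number of translates of the $i$-th prototile in $\omega$ of the $j$-th) is positive, and has FLC if for each compact $K$ the set $\{\omega^n(P)\sqcap(K+x): n>0,P\in\mathcal{A},x\in\mathbb{R}^d\}$ is finite up to translation. A self-affine tiling for $\omega$ is a tiling consisting of translates of prototiles with $\omega(\mathcal{T})=\mathcal{T}$, having FLC and being repetitive. *)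

theory Defs
  imports "HOL-Analysis.Analysis" "HOL-Computational_Algebra.Polynomial"
begin

text \<open>Tiles in R^d (d = CARD('n)): a support set together with a label.\<close>
type_synonym ('n, 'l) tile = "(real^'n) set \<times> 'l"

definition is_tile :: "('n::finite, 'l) tile \<Rightarrow> bool" where
  "is_tile T \<longleftrightarrow> compact (fst T) \<and> closure (interior (fst T)) = fst T \<and> fst T \<noteq> {}"

definition tr :: "('n::finite, 'l) tile \<Rightarrow> real^'n \<Rightarrow> ('n, 'l) tile" where
  "tr T x = ((\<lambda>v. v + x) ` fst T, snd T)"

definition tr_patch :: "('n::finite, 'l) tile set \<Rightarrow> real^'n \<Rightarrow> ('n, 'l) tile set" where
  "tr_patch P x = (\<lambda>T. tr T x) ` P"

definition is_patch :: "('n::finite, 'l) tile set \<Rightarrow> bool" where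
  "is_patch P \<longleftrightarrow> (\<forall>T\<in>P. is_tile T) \<and>
     (\<forall>T\<in>P. \<forall>T'\<in>P. T \<noteq> T' \<longrightarrow> interior (fst T) \<inter> interior (fst T') = {})"

definition supp :: "('n::finite, 'l) tile set \<Rightarrow> (real^'n) set" where
  "supp P = closure (\<Union>T\<in>P. fst T)"

definition is_tiling :: "('n::finite, 'l) tile set \<Rightarrow> bool" where
  "is_tiling P \<longleftrightarrow> is_patch P \<and> supp P = UNIV"

text \<open>A (finite) set of tiles P is T-legal if some translate of it is contained in T.\<close>
definition legal :: "('n::finite, 'l) tile set \<Rightarrow> ('n, 'l) tile set \<Rightarrow> bool" where
  "legal \<T> P \<longleftrightarrow> (\<exists>x. tr_patch P x \<subseteq> \<T>)"

definition sqcap :: "('n::finite, 'l) tile set \<Rightarrow> (real^'n) set \<Rightarrow> ('n, 'l) tile set" where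
  "sqcap P S = {T \<in> P. fst T \<inter> S \<noteq> {}}"

definition finite_upto_tr :: "('n::finite, 'l) tile set set \<Rightarrow> bool" where
  "finite_upto_tr Ps \<longleftrightarrow> (\<exists>F. finite F \<and> (\<forall>P\<in>Ps. \<exists>P'\<in>F. \<exists>y. P = tr_patch P' y))"

definition tiling_FLC :: "('n::finite, 'l) tile set \<Rightarrow> bool" where
  "tiling_FLC \<T> \<longleftrightarrow> (\<forall>K. compact K \<longrightarrow>
      finite_upto_tr {sqcap \<T> ((\<lambda>v. v + x) ` K) | x. True})"

definition repetitive :: "('n::finite, 'l) tile set \<Rightarrow> bool" where
  "repetitive \<T> \<longleftrightarrow> (\<forall>P. finite P \<and> is_patch P \<and> legal \<T> P \<longrightarrow>
      (\<exists>R>0. \<forall>c. \<exists>x. tr_patch P x \<subseteq> \<T> \<and> supp (tr_patch P x) \<subseteq> cball c R))"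

definition return_vector :: "('n::finite, 'l) tile set \<Rightarrow> real^'n \<Rightarrow> bool" where
  "return_vector \<T> x \<longleftrightarrow> (\<exists>T\<in>\<T>. tr T x \<in> \<T>)"

text \<open>Linear algebra of the expansion map Q (a real d x d matrix).\<close>
definition cmat :: "real^'n^'m \<Rightarrow> complex^'n^'m" where
  "cmat Q = (\<chi> i j. complex_of_real (Q $ i $ j))"

definition charpoly :: "real^'n::finite^'n \<Rightarrow> complex poly" where
  "charpoly Q = det (\<chi> i j. (if i = j then [:0, 1:] else 0) - [: cmat Q $ i $ j :])"

definition eigenvalue :: "real^'n::finite^'n \<Rightarrow> complex \<Rightarrow> bool" where
  "eigenvalue Q z \<longleftrightarrow> poly (charpoly Q) z = 0"

text \<open>Algebraic multiplicity of an eigenvalue.\<close>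
definition eig_mult :: "real^'n::finite^'n \<Rightarrow> complex \<Rightarrow> nat" where
  "eig_mult Q z = order z (charpoly Q)"

definition expansion :: "real^'n::finite^'n \<Rightarrow> bool" where
  "expansion Q \<longleftrightarrow> (\<forall>z. eigenvalue Q z \<longrightarrow> cmod z > 1)"

definition diagonalizable_C :: "real^'n::finite^'n \<Rightarrow> bool" where
  "diagonalizable_C Q \<longleftrightarrow> (\<exists>P D :: complex^'n^'n. invertible P \<and>
      (\<forall>i j. i \<noteq> j \<longrightarrow> D $ i $ j = 0) \<and> cmat Q = P ** D ** matrix_inv P)"

text \<open>Algebraic conjugates: roots of a common irreducible polynomial over Q.\<close>
definition alg_conj :: "complex \<Rightarrow> complex \<Rightarrow> bool" where
  "alg_conj a b \<longleftrightarrow> (\<exists>p :: rat poly. irreducible p \<and>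
      poly (map_poly of_rat p) a = 0 \<and> poly (map_poly of_rat p) b = 0)"

text \<open>Substitution rules. \<omega> is given as a map on tiles; on prototiles it is the
  substitution, and it is extended to translates by \<omega>(P+x) = \<omega>(P)+Qx and to patches by unions.\<close>
definition omega_patch :: "(('n::finite, 'l) tile \<Rightarrow> ('n, 'l) tile set) \<Rightarrow> ('n, 'l) tile set \<Rightarrow> ('n, 'l) tile set" where
  "omega_patch \<omega> P = (\<Union>T\<in>P. \<omega> T)"

definition subst_rule :: "('n::finite, 'l) tile set \<Rightarrow> real^'n^'n \<Rightarrow> (('n, 'l) tile \<Rightarrow> ('n, 'l) tile set) \<Rightarrow> bool" where
  "subst_rule A Q \<omega> \<longleftrightarrow> finite A \<and> (\<forall>P\<in>A. is_tile P) \<and> expansion Q \<and>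
     (\<forall>P\<in>A. finite (\<omega> P) \<and> is_patch (\<omega> P) \<and>
        (\<forall>T\<in>\<omega> P. \<exists>P'\<in>A. \<exists>y. T = tr P' y) \<and>
        supp (\<omega> P) = (\<lambda>v. Q *v v) ` fst P) \<and>
     (\<forall>P\<in>A. \<forall>x. \<omega> (tr P x) = tr_patch (\<omega> P) (Q *v x))"

text \<open>Substitution matrix entry (P, P'): number of translates of prototile P in \<omega>(P').\<close>
definition subst_matrix :: "('n::finite, 'l) tile set \<Rightarrow> (('n, 'l) tile \<Rightarrow> ('n, 'l) tile set) \<Rightarrow> ('n, 'l) tile \<Rightarrow> ('n, 'l) tile \<Rightarrow> nat" where
  "subst_matrix A \<omega> P P' = card {x. tr P x \<in> \<omega> P'}"

fun subst_matrix_pow :: "('n::finite, 'l) tile set \<Rightarrow> (('n, 'l) tile \<Rightarrow> ('n, 'l) tile set) \<Rightarrow> nat \<Rightarrow> ('n, 'l) tile \<Rightarrow> ('n, 'l) tile \<Rightarrow> nat" where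
  "subst_matrix_pow A \<omega> 0 P P' = (if P = P' then 1 else 0)"
| "subst_matrix_pow A \<omega> (Suc k) P P' = (\<Sum>R\<in>A. subst_matrix A \<omega> P R * subst_matrix_pow A \<omega> k R P')"

definition primitive :: "('n::finite, 'l) tile set \<Rightarrow> (('n, 'l) tile \<Rightarrow> ('n, 'l) tile set) \<Rightarrow> bool" where
  "primitive A \<omega> \<longleftrightarrow> (\<exists>k>0. \<forall>P\<in>A. \<forall>P'\<in>A. subst_matrix_pow A \<omega> k P P' > 0)"

definition subst_FLC :: "('n::finite, 'l) tile set \<Rightarrow> (('n, 'l) tile \<Rightarrow> ('n, 'l) tile set) \<Rightarrow> bool" where
  "subst_FLC A \<omega> \<longleftrightarrow> (\<forall>K. compact K \<longrightarrow>
     finite_upto_tr {sqcap ((omega_patch \<omega> ^^ n) {P}) ((\<lambda>v. v + x) ` K) | n P x. n > 0 \<and> P \<in> A})"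

definition self_affine_tiling :: "('n::finite, 'l) tile set \<Rightarrow> real^'n^'n \<Rightarrow> (('n, 'l) tile \<Rightarrow> ('n, 'l) tile set) \<Rightarrow> ('n, 'l) tile set \<Rightarrow> bool" where
  "self_affine_tiling A Q \<omega> \<T> \<longleftrightarrow> is_tiling \<T> \<and> (\<forall>T\<in>\<T>. \<exists>P\<in>A. \<exists>y. T = tr P y) \<and>
     omega_patch \<omega> \<T> = \<T> \<and> tiling_FLC \<T> \<and> repetitive \<T>"

end

theory Submission
  imports Defs "HOL-Computational_Algebra.Polynomial_Factorial" "HOL-Computational_Algebra.Field_as_Ring"
begin

(*
  Let p be the minimal polynomial over the rationals of the eigenvalues of Q and beta a root of p
  with |beta| < 1.  Since Q is diagonalisable over the complex numbers with all eigenvalues roots of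
  p, we have p(Q) = 0, and for x <> 0 the vectors x, Qx, ..., Q^(k-1) x (k = deg p) are linearly
  independent over the rationals.  Choosing a rational-linear g with g(Q^j x) = delta_j0 and
  writing p = (X - beta) q, the map psi(v) = sum_j q_j g(Q^j v) is additive, satisfies
  psi(Qv) = beta psi(v), and psi(x) = q_0 <> 0.

  Each tile position y of the tiling has a parent position y' with y - Q y' in the finite digit
  set of the substitution, and following parents leads, since Q is expanding, to an ancestor near
  the origin.  Hence psi(y) = sum_j beta^j psi(t_j) + beta^n psi(y_n) is bounded by some B.  If
  T and T + nx both belong to the tiling, then |n psi(x)| <= 2B, which bounds n.
*)

section \<open>Rational polynomials and their complex roots\<close>

lemma of_real_of_rat: "(of_real (of_rat q) :: 'a::real_field) = of_rat q"
  by (induction q) (simp add: of_rat_rat)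

lemma map_poly_of_rat_add:
  "map_poly of_rat (p + q) = (map_poly of_rat p + map_poly of_rat q :: 'a::field_char_0 poly)"
  by (rule poly_eqI) (simp add: coeff_map_poly of_rat_add)

lemma map_poly_of_rat_mult:
  "map_poly of_rat (p * q) = (map_poly of_rat p * map_poly of_rat q :: 'a::field_char_0 poly)"
  by (rule poly_eqI) (simp add: coeff_map_poly coeff_mult of_rat_sum of_rat_mult)

lemma irreducible_dvd_if_common_root:
  fixes p r :: "rat poly" and c :: "'a::field_char_0"
  assumes irr: "irreducible p" and "r \<noteq> 0"
    and "poly (map_poly of_rat p) c = 0" "poly (map_poly of_rat r) c = 0"
  shows "p dvd r"
proof -
  define d where "d = gcd p r"
  obtain a b where "a * p + b * r = d"
    using bezout_coefficients_fst_snd[of p r] unfolding d_def by blast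
  then have "poly (map_poly of_rat d) c = 0"
    using assms(3,4) by (auto simp: map_poly_of_rat_add map_poly_of_rat_mult)
  then have "\<not> is_unit d"
    by (auto simp: is_unit_poly_iff map_poly_pCons)
  moreover have "d dvd p"
    by (simp add: d_def)
  ultimately have "p dvd d"
    using irr by (auto simp: irreducible_altdef)
  also have "d dvd r"
    by (simp add: d_def)
  finally show ?thesis .
qed

lemma alg_conj_root:
  assumes "irreducible p" "poly (map_poly of_rat p) z = 0" "alg_conj z \<mu>"
  shows "poly (map_poly of_rat p) \<mu> = 0"
proof -
  obtain p' where "irreducible p'" "poly (map_poly of_rat p') z = 0" "poly (map_poly of_rat p') \<mu> = 0"
    using assms(3) unfolding alg_conj_def by blast
  moreover have "p \<noteq> 0"
    using assms(1) by auto
  ultimately have "p' dvd p"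
    using assms(2) irreducible_dvd_if_common_root by blast
  with \<open>poly (map_poly of_rat p') \<mu> = 0\<close> show ?thesis
    by (auto simp: map_poly_of_rat_mult)
qed

lemma irreducible_coeff_0_nonzero:
  fixes z :: "'a::field_char_0"
  assumes irr: "irreducible p" and "poly (map_poly of_rat p) z = 0" "z \<noteq> 0"
  shows "coeff p 0 \<noteq> 0"
proof
  assume "coeff p 0 = 0"
  then have "poly (map_poly of_rat p) (0::'a) = 0"
    by (simp add: poly_0_coeff_0 coeff_map_poly)
  then have "p dvd [:0, 1:]"
    using irreducible_dvd_if_common_root[OF irr, of "[:0, 1:]" "0::'a"] by (simp add: map_poly_pCons)
  then have "poly (map_poly of_rat [:0, 1:]) z = 0"
    using assms(2) by (auto simp: map_poly_of_rat_mult)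
  with \<open>z \<noteq> 0\<close> show False
    by (simp add: map_poly_pCons)
qed

lemma degree_pos_if_root:
  fixes z :: "'a::field_char_0"
  assumes "irreducible p" "poly (map_poly of_rat p) z = 0"
  shows "degree p > 0"
proof (rule ccontr)
  assume "\<not> degree p > 0"
  then obtain a where "p = [:a:]"
    by (metis degree_eq_zeroE neq0_conv)
  moreover have "a \<noteq> 0"
    using assms(1) calculation by auto
  ultimately show False
    using assms(2) by (simp add: map_poly_pCons)
qed

lemma sum_coeff_mult_linear_factor:
  fixes q :: "'a::comm_ring_1 poly"
  assumes "degree q < k"
  shows "(\<Sum>j\<le>k. coeff ([:- \<beta>, 1:] * q) j * h j)
    = (\<Sum>j<k. coeff q j * h (Suc j)) - \<beta> * (\<Sum>j<k. coeff q j * h j)"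
proof -
  have "coeff q k = 0"
    using assms by (simp add: coeff_eq_0)
  have "(\<Sum>j\<le>k. coeff ([:- \<beta>, 1:] * q) j * h j)
      = - \<beta> * coeff q 0 * h 0 + (\<Sum>j<k. (coeff q j - \<beta> * coeff q (Suc j)) * h (Suc j))"
    by (simp add: sum.atMost_shift algebra_simps)
  also have "\<dots> = (\<Sum>j<k. coeff q j * h (Suc j)) - \<beta> * (\<Sum>j<Suc k. coeff q j * h j)"
    by (simp add: sum.lessThan_Suc_shift algebra_simps sum_subtractf sum_distrib_left del: sum.lessThan_Suc)
  also have "(\<Sum>j<Suc k. coeff q j * h j) = (\<Sum>j<k. coeff q j * h j)"
    using \<open>coeff q k = 0\<close> by simp
  finally show ?thesis .
qed

section \<open>Complex diagonalisation of a real matrix\<close>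

definition cvec :: "real^'n \<Rightarrow> complex^'n" where
  "cvec v = (\<chi> i. complex_of_real (v $ i))"

lemma cvec_add: "cvec (a + b) = cvec a + cvec b"
  by (simp add: cvec_def vec_eq_iff)

lemma cvec_scaleR: "cvec (c *\<^sub>R a) = of_real c *s cvec a"
  by (simp add: cvec_def vec_eq_iff)

lemma cvec_sum: "cvec (sum f S) = (\<Sum>j\<in>S. cvec (f j))"
  by (induction S rule: infinite_finite_induct) (auto simp: cvec_add cvec_def vec_eq_iff)

lemma cvec_eq_0_iff: "cvec a = 0 \<longleftrightarrow> a = 0"
  by (simp add: cvec_def vec_eq_iff)

lemma cvec_matrix_vector_mult: "cvec (Q *v v) = cmat Q *v cvec v"
  by (simp add: cvec_def cmat_def vec_eq_iff matrix_vector_mult_def)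

definition poly_mat_vec :: "real^'n^'n \<Rightarrow> rat poly \<Rightarrow> real^'n \<Rightarrow> real^'n" where
  "poly_mat_vec Q r v = (\<Sum>j\<le>degree r. of_rat (coeff r j) *\<^sub>R ((*v) Q ^^ j) v)"

lemma poly_mat_vec_eq_sum:
  assumes "degree r < N"
  shows "poly_mat_vec Q r v = (\<Sum>j<N. of_rat (coeff r j) *\<^sub>R ((*v) Q ^^ j) v)"
  unfolding poly_mat_vec_def
  by (rule sum.mono_neutral_left) (use assms in \<open>auto simp: coeff_eq_0\<close>)

lemma linear_matrix_vector_mult_funpow:
  fixes Q :: "real^'n^'n"
  shows "linear ((*v) Q ^^ j)"
proof (induction j)
  case 0
  show ?case
    by (simp add: linear_iff)
next
  case (Suc j)
  then show ?case
    using linear_compose[OF Suc matrix_vector_mul_linear[of Q]] by (simp add: o_def)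
qed

lemma matrix_vector_mult_sum: "(A::'a::comm_semiring_1^'n^'m) *v sum f S = (\<Sum>j\<in>S. A *v f j)"
  by (induction S rule: infinite_finite_induct) (auto simp: matrix_vector_right_distrib)

lemma mat_matrix_vector_mult: "(mat c :: 'a::comm_semiring_1^'n^'n) *v w = c *s w"
proof -
  have "(\<Sum>j\<in>UNIV. (if i = j then c else 0) * w $ j) = c * w $ i" for i
    by (subst sum.remove[of _ i]) auto
  then show ?thesis
    by (simp add: matrix_vector_mult_def mat_def vec_eq_iff)
qed

lemma poly_det: "poly (det M) c = det (\<chi> i j. poly (M $ i $ j) c)"
  unfolding det_def by (simp add: poly_sum poly_prod)

lemma eigenvalue_iff_det:
  fixes Q :: "real^'n::finite^'n"
  shows "eigenvalue Q c \<longleftrightarrow> det (mat c - cmat Q) = 0"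
proof -
  have "(\<chi> i j. poly (((\<chi> i j. (if i = j then [:0, 1:] else 0) - [: cmat Q $ i $ j :])
      :: complex poly^'n^'n) $ i $ j) c) = mat c - cmat Q"
    by (simp add: vec_eq_iff mat_def)
  then show ?thesis
    unfolding eigenvalue_def charpoly_def poly_det by simp
qed

lemma det_eq_0_if_kernel:
  fixes A :: "'a::field^'n^'n"
  assumes "A *v w = 0" "w \<noteq> 0"
  shows "det A = 0"
proof -
  have "\<not> inj ((*v) A)"
    using assms by (metis inj_eq matrix_vector_mult_0_right)
  then show ?thesis
    using det_nz_iff_inj_gen[of "(*v) A"] by simp
qed

locale complex_diagonalization =
  fixes Q :: "real^'n::finite^'n" and P D :: "complex^'n^'n"
  assumes invertible_P: "invertible P"
    and diagonal_D: "\<And>i j. i \<noteq> j \<Longrightarrow> D $ i $ j = 0"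
    and cmat_Q: "cmat Q = P ** D ** matrix_inv P"
begin

lemma P_matrix_inv: "P ** matrix_inv P = mat 1" "matrix_inv P ** P = mat 1"
  using someI_ex[OF invertible_P[unfolded invertible_def]] by (simp_all add: matrix_inv_def)

definition eigencoords :: "real^'n \<Rightarrow> complex^'n" where
  "eigencoords v = matrix_inv P *v cvec v"

lemma cvec_eq_eigencoords: "cvec v = P *v eigencoords v"
  by (simp add: eigencoords_def matrix_vector_mul_assoc P_matrix_inv)

lemma eigencoords_eq_0_iff: "eigencoords v = 0 \<longleftrightarrow> v = 0"
  by (metis cvec_eq_0_iff cvec_eq_eigencoords eigencoords_def matrix_vector_mult_0_right)

lemma diagonal_mult: "D *v e = (\<chi> i. D $ i $ i * e $ i)"
proof -
  have "(\<Sum>j\<in>UNIV. D $ i $ j * e $ j) = D $ i $ i * e $ i" for i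
    using diagonal_D by (subst sum.remove[of _ i]) auto
  then show ?thesis
    by (simp add: matrix_vector_mult_def vec_eq_iff)
qed

lemma cmat_Q_mult_P: "cmat Q *v (P *v e) = P *v (\<chi> i. D $ i $ i * e $ i)"
  by (simp add: cmat_Q matrix_vector_mul_assoc[symmetric] diagonal_mult)
    (simp add: matrix_vector_mul_assoc P_matrix_inv)

lemma eigencoords_mult: "eigencoords (Q *v v) = (\<chi> i. D $ i $ i * eigencoords v $ i)"
proof -
  have "cvec (Q *v v) = cmat Q *v (P *v eigencoords v)"
    by (simp add: cvec_matrix_vector_mult flip: cvec_eq_eigencoords)
  also have "\<dots> = P *v (\<chi> i. D $ i $ i * eigencoords v $ i)"
    by (rule cmat_Q_mult_P)
  finally show ?thesis
    by (simp add: eigencoords_def matrix_vector_mul_assoc P_matrix_inv)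
qed

lemma eigencoords_funpow: "eigencoords (((*v) Q ^^ j) v) = (\<chi> i. D $ i $ i ^ j * eigencoords v $ i)"
  by (induction j) (simp_all add: eigencoords_mult vec_eq_iff)

lemma eigencoords_poly_mat_vec:
  "eigencoords (poly_mat_vec Q r v) = (\<chi> i. poly (map_poly of_rat r) (D $ i $ i) * eigencoords v $ i)"
proof -
  have "eigencoords (poly_mat_vec Q r v)
      = (\<Sum>j\<le>degree r. of_rat (coeff r j) *s eigencoords (((*v) Q ^^ j) v))"
    by (simp add: poly_mat_vec_def eigencoords_def cvec_sum cvec_scaleR of_real_of_rat
      matrix_vector_mult_sum vector_scalar_commute)
  also have "\<dots> = (\<chi> i. poly (map_poly of_rat r) (D $ i $ i) * eigencoords v $ i)"
    by (simp add: eigencoords_funpow vec_eq_iff poly_altdef degree_map_poly coeff_map_poly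
      sum_distrib_right mult.assoc)
  finally show ?thesis .
qed

lemma eigenvalue_diagonal: "eigenvalue Q (D $ i $ i)"
proof -
  define w where "w = P *v axis i 1"
  have "matrix_inv P *v w = axis i 1"
    by (simp add: w_def matrix_vector_mul_assoc P_matrix_inv)
  then have "w \<noteq> 0"
    by auto
  moreover have "(\<chi> j. D $ j $ j * axis i 1 $ j) = D $ i $ i *s axis i (1::complex)"
    by (simp add: vec_eq_iff axis_def)
  then have "(mat (D $ i $ i) - cmat Q) *v w = 0"
    by (simp add: w_def cmat_Q_mult_P matrix_vector_mult_diff_rdistrib vector_scalar_commute
      mat_matrix_vector_mult)
  ultimately show ?thesis
    unfolding eigenvalue_iff_det by (rule det_eq_0_if_kernel[rotated])
qed

end

section \<open>An additive eigenfunctional for a conjugate eigenvalue\<close>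

abbreviation rat_linear :: "('a::real_vector \<Rightarrow> real) \<Rightarrow> bool" where
  "rat_linear \<equiv> Vector_Spaces.linear (\<lambda>r v. of_rat r *\<^sub>R v) (\<lambda>r t. of_rat r * t)"

interpretation rat_real: vector_space_pair
  "\<lambda>r v. of_rat r *\<^sub>R (v::'a::real_vector)" "\<lambda>r (t::real). of_rat r * t"
  by unfold_locales
    (auto simp: of_rat_add of_rat_mult scaleR_add_right scaleR_add_left distrib_left distrib_right)

lemma rat_linear_additive: "rat_linear g \<Longrightarrow> Modules.additive g"
  unfolding Vector_Spaces.linear_iff_module_hom by (simp add: additive.intro module_hom.add)

lemma rat_linear_scale: "rat_linear g \<Longrightarrow> g (of_rat c *\<^sub>R v) = of_rat c * g v"
  unfolding Vector_Spaces.linear_iff_module_hom by (rule module_hom.scale)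

context complex_diagonalization
begin

lemma poly_mat_vec_eq_0:
  assumes "\<And>i. poly (map_poly of_rat r) (D $ i $ i) = 0"
  shows "poly_mat_vec Q r v = 0"
  unfolding eigencoords_eq_0_iff[symmetric] eigencoords_poly_mat_vec using assms
  by (simp add: vec_eq_iff)

lemma poly_mat_vec_neq_0:
  assumes irr: "irreducible p" and roots: "\<And>i. poly (map_poly of_rat p) (D $ i $ i) = 0"
    and "r \<noteq> 0" "degree r < degree p" "x \<noteq> 0"
  shows "poly_mat_vec Q r x \<noteq> 0"
proof
  assume "poly_mat_vec Q r x = 0"
  then have "(\<chi> i. poly (map_poly of_rat r) (D $ i $ i) * eigencoords x $ i) = 0"
    by (simp add: eigencoords_eq_0_iff flip: eigencoords_poly_mat_vec)
  then have zero: "poly (map_poly of_rat r) (D $ i $ i) * eigencoords x $ i = 0" for i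
    by (simp add: vec_eq_iff)
  obtain i where "eigencoords x $ i \<noteq> 0"
    using \<open>x \<noteq> 0\<close> eigencoords_eq_0_iff by (auto simp: vec_eq_iff)
  then have "p dvd r"
    using zero[of i] irreducible_dvd_if_common_root[OF irr \<open>r \<noteq> 0\<close> roots] by simp
  then show False
    using \<open>r \<noteq> 0\<close> \<open>degree r < degree p\<close> by (auto dest: dvd_imp_degree_le)
qed

lemma rat_combination_of_powers_eq_0:
  assumes irr: "irreducible p" and roots: "\<And>i. poly (map_poly of_rat p) (D $ i $ i) = 0"
    and "x \<noteq> 0" and comb: "(\<Sum>j<degree p. of_rat (c j) *\<^sub>R ((*v) Q ^^ j) x) = 0"
    and "j < degree p"
  shows "c j = 0"
proof -
  define r where "r = (\<Sum>j<degree p. monom (c j) j)"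
  have coeff_r: "coeff r j = (if j < degree p then c j else 0)" for j
    by (simp add: r_def coeff_sum)
  have "r = 0"
  proof (rule ccontr)
    assume "r \<noteq> 0"
    then have "degree r < degree p"
      by (intro degree_lessI) (auto simp: coeff_r)
    then have "poly_mat_vec Q r x = 0"
      using comb by (simp add: poly_mat_vec_eq_sum coeff_r)
    with poly_mat_vec_neq_0[OF irr roots \<open>r \<noteq> 0\<close> \<open>degree r < degree p\<close> \<open>x \<noteq> 0\<close>] show False ..
  qed
  then show ?thesis
    using coeff_r[of j] \<open>j < degree p\<close> by simp
qed

lemma inj_on_powers:
  assumes irr: "irreducible p" and roots: "\<And>i. poly (map_poly of_rat p) (D $ i $ i) = 0"
    and "x \<noteq> 0"
  shows "inj_on (\<lambda>j. ((*v) Q ^^ j) x) {..<degree p}"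
proof (rule inj_onI, rule ccontr)
  let ?f = "\<lambda>j. ((*v) Q ^^ j) x"
  fix i j assume ij: "i \<in> {..<degree p}" "j \<in> {..<degree p}" "?f i = ?f j" "i \<noteq> j"
  define c where "c l = (if l = i then 1 else if l = j then -1 else (0::rat))" for l
  have "of_rat (c l) *\<^sub>R ?f l = (if l = i then ?f l else 0) - (if l = j then ?f l else 0)" for l
    using ij(4) by (simp add: c_def)
  then have "(\<Sum>l<degree p. of_rat (c l) *\<^sub>R ?f l) = 0"
    using ij(1-3) by (simp add: sum_subtractf)
  then have "c i = 0"
    using rat_combination_of_powers_eq_0[OF irr roots \<open>x \<noteq> 0\<close>] ij(1) by blast
  then show False
    by (simp add: c_def)
qed

lemma independent_powers:
  assumes irr: "irreducible p" and roots: "\<And>i. poly (map_poly of_rat p) (D $ i $ i) = 0"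
    and "x \<noteq> 0"
  shows "rat_real.vs1.independent ((\<lambda>j. ((*v) Q ^^ j) x) ` {..<degree p})"
proof (rule rat_real.vs1.independent_if_scalars_zero)
  let ?f = "\<lambda>j. ((*v) Q ^^ j) x"
  fix u v assume sum: "(\<Sum>v\<in>?f ` {..<degree p}. of_rat (u v) *\<^sub>R v) = 0"
    and v: "v \<in> ?f ` {..<degree p}"
  have "(\<Sum>j<degree p. of_rat (u (?f j)) *\<^sub>R ?f j) = 0"
    using sum by (simp add: sum.reindex[OF inj_on_powers[OF irr roots \<open>x \<noteq> 0\<close>]])
  moreover obtain j where "j < degree p" "v = ?f j"
    using v by blast
  ultimately show "u v = 0"
    using rat_combination_of_powers_eq_0[OF irr roots \<open>x \<noteq> 0\<close>, where c="\<lambda>j. u (?f j)"] by blast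
qed simp

lemma exists_dual_functional_of_powers:
  assumes irr: "irreducible p" and roots: "\<And>i. poly (map_poly of_rat p) (D $ i $ i) = 0"
    and "x \<noteq> 0"
  obtains g where "rat_linear g" "\<And>j. j < degree p \<Longrightarrow> g (((*v) Q ^^ j) x) = (if j = 0 then 1 else 0)"
proof -
  let ?f = "\<lambda>j. ((*v) Q ^^ j) x"
  obtain g where g: "rat_linear g" "\<And>v. v \<in> ?f ` {..<degree p} \<Longrightarrow> g v = (if v = x then 1 else 0)"
    using rat_real.linear_independent_extend[OF independent_powers[OF irr roots \<open>x \<noteq> 0\<close>],
        of "\<lambda>v. if v = x then 1 else 0"]
    by blast
  have "g (?f j) = (if j = 0 then 1 else 0)" if "j < degree p" for j
  proof -
    have "?f j = x \<longleftrightarrow> j = 0"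
      using inj_onD[OF inj_on_powers[OF irr roots \<open>x \<noteq> 0\<close>], of j 0] that by auto
    then show ?thesis
      using g(2) that by auto
  qed
  with g(1) show ?thesis
    using that by blast
qed

lemma cofactor_functional_eigen:
  fixes q :: "complex poly"
  assumes roots: "\<And>i. poly (map_poly of_rat p) (D $ i $ i) = 0" and g: "rat_linear g"
    and q: "map_poly of_rat p = [:- \<beta>, 1:] * q" and "degree q < degree p"
  shows "(\<Sum>j<degree p. coeff q j * of_real (g (((*v) Q ^^ j) (Q *v v))))
    = \<beta> * (\<Sum>j<degree p. coeff q j * of_real (g (((*v) Q ^^ j) v)))"
proof -
  define h where "h j = complex_of_real (g (((*v) Q ^^ j) v))" for j
  have "0 = complex_of_real (g (poly_mat_vec Q p v))"
    using poly_mat_vec_eq_0[OF roots] additive.zero[OF rat_linear_additive[OF g]] by simp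
  also have "\<dots> = (\<Sum>j\<le>degree p. coeff (map_poly of_rat p) j * h j)"
    by (simp add: poly_mat_vec_def h_def additive.sum[OF rat_linear_additive[OF g]]
      rat_linear_scale[OF g] coeff_map_poly of_real_of_rat)
  also have "\<dots> = (\<Sum>j<degree p. coeff q j * h (Suc j)) - \<beta> * (\<Sum>j<degree p. coeff q j * h j)"
    unfolding q by (rule sum_coeff_mult_linear_factor[OF \<open>degree q < degree p\<close>])
  finally show ?thesis
    by (simp add: h_def funpow_Suc_right del: funpow.simps)
qed

lemma exists_additive_eigenfunctional:
  assumes irr: "irreducible p" and roots: "\<And>i. poly (map_poly of_rat p) (D $ i $ i) = 0"
    and \<beta>: "poly (map_poly of_rat p) \<beta> = 0" and "coeff p 0 \<noteq> 0" and "x \<noteq> 0"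
  obtains \<psi> :: "real^'n \<Rightarrow> complex"
  where "Modules.additive \<psi>" "\<And>v. \<psi> (Q *v v) = \<beta> * \<psi> v" "\<psi> x \<noteq> 0"
proof -
  obtain g where g: "rat_linear g"
    and g_powers: "\<And>j. j < degree p \<Longrightarrow> g (((*v) Q ^^ j) x) = (if j = 0 then 1 else 0)"
    using exists_dual_functional_of_powers[OF irr roots \<open>x \<noteq> 0\<close>] by blast
  obtain q where q: "map_poly of_rat p = [:- \<beta>, 1:] * q"
    using \<beta> by (auto simp: poly_eq_0_iff_dvd)
  have "degree p > 0"
    by (rule degree_pos_if_root[OF irr \<beta>])
  then have "q \<noteq> 0"
    using q by (auto simp: map_poly_eq_0_iff)
  then have "degree (map_poly of_rat p :: complex poly) = Suc (degree q)"
    unfolding q by (subst degree_mult_eq) auto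
  then have "degree q < degree p"
    by (simp add: degree_map_poly)
  define \<psi> where "\<psi> v = (\<Sum>j<degree p. coeff q j * of_real (g (((*v) Q ^^ j) v)))" for v
  have "Modules.additive \<psi>"
  proof
    fix u v
    show "\<psi> (u + v) = \<psi> u + \<psi> v"
      by (simp add: \<psi>_def linear_add[OF linear_matrix_vector_mult_funpow]
        additive.add[OF rat_linear_additive[OF g]] distrib_left sum.distrib)
  qed
  moreover have "\<psi> (Q *v v) = \<beta> * \<psi> v" for v
    unfolding \<psi>_def by (rule cofactor_functional_eigen[OF roots g q \<open>degree q < degree p\<close>])
  moreover have "\<psi> x = coeff q 0"
  proof -
    have "\<psi> x = (\<Sum>j<degree p. if j = 0 then coeff q 0 else 0)"
      unfolding \<psi>_def by (rule sum.cong) (auto simp: g_powers)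
    also have "\<dots> = coeff q 0"
      using \<open>degree p > 0\<close> by simp
    finally show ?thesis .
  qed
  moreover have "coeff q 0 \<noteq> 0"
    using arg_cong[OF q, of "\<lambda>r. coeff r 0"] \<open>coeff p 0 \<noteq> 0\<close> by (auto simp: coeff_map_poly)
  ultimately show ?thesis
    using that by metis
qed

end

lemma backward_orbit_tendsto_0:
  fixes Q :: "real^'n::finite^'n"
  assumes "diagonalizable_C Q" "expansion Q" and orbit: "\<And>n. Q *v a (Suc n) = a n"
  shows "a \<longlonglongrightarrow> 0"
proof -
  obtain P D where "complex_diagonalization Q P D"
    using assms(1) unfolding diagonalizable_C_def complex_diagonalization_def by blast
  then interpret complex_diagonalization Q P D .
  have expanding: "cmod (D $ i $ i) > 1" for i
    using assms(2) eigenvalue_diagonal by (simp add: expansion_def)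
  have coords: "eigencoords (a n) $ i = eigencoords (a 0) $ i * inverse (D $ i $ i) ^ n" for n i
  proof (induction n)
    case (Suc n)
    have "eigencoords (a n) $ i = D $ i $ i * eigencoords (a (Suc n)) $ i"
      using eigencoords_mult[of "a (Suc n)"] orbit[of n] by simp
    then have "eigencoords (a (Suc n)) $ i = eigencoords (a n) $ i * inverse (D $ i $ i)"
      using expanding[of i] by (auto simp: field_simps)
    with Suc show ?case
      by (simp add: ac_simps)
  qed simp
  have "(\<lambda>n. eigencoords (a n) $ i) \<longlonglongrightarrow> 0" for i
  proof -
    have "(\<lambda>n. eigencoords (a 0) $ i * inverse (D $ i $ i) ^ n) \<longlonglongrightarrow> 0"
      using expanding[of i] by (intro tendsto_mult_right_zero LIMSEQ_power_zero)
        (simp add: norm_inverse inverse_less_1_iff)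
    moreover have "(\<lambda>n. eigencoords (a n) $ i) = (\<lambda>n. eigencoords (a 0) $ i * inverse (D $ i $ i) ^ n)"
      by (rule ext) (rule coords)
    ultimately show ?thesis
      by simp
  qed
  then have "(\<lambda>n. cvec (a n) $ j) \<longlonglongrightarrow> 0" for j
    unfolding cvec_eq_eigencoords matrix_vector_mult_def vec_lambda_beta
    by (intro tendsto_null_sum tendsto_mult_right_zero)
  then have "(\<lambda>n. a n $ j) \<longlonglongrightarrow> 0" for j
    using tendsto_Re[of "\<lambda>n. cvec (a n) $ j" 0] by (simp add: cvec_def)
  then show ?thesis
    by (intro vec_tendstoI) simp
qed

lemma exists_conjugate_eigenfunctional:
  fixes Q :: "real^'n::finite^'n"
  assumes "diagonalizable_C Q" "expansion Q"
    and conj: "\<forall>z \<mu>. eigenvalue Q z \<and> eigenvalue Q \<mu> \<longrightarrow> alg_conj z \<mu>"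
    and z: "eigenvalue Q z" and "alg_conj z \<beta>" and "x \<noteq> 0"
  obtains \<psi> :: "real^'n \<Rightarrow> complex"
  where "Modules.additive \<psi>" "\<And>v. \<psi> (Q *v v) = \<beta> * \<psi> v" "\<psi> x \<noteq> 0"
proof -
  obtain P D where "complex_diagonalization Q P D"
    using assms(1) unfolding diagonalizable_C_def complex_diagonalization_def by blast
  then interpret complex_diagonalization Q P D .
  obtain p where irr: "irreducible p"
    and pz: "poly (map_poly of_rat p) z = 0" and p\<beta>: "poly (map_poly of_rat p) \<beta> = 0"
    using \<open>alg_conj z \<beta>\<close> unfolding alg_conj_def by blast
  have "poly (map_poly of_rat p) (D $ i $ i) = 0" for i
    using alg_conj_root[OF irr pz] conj z eigenvalue_diagonal by blast
  moreover have "coeff p 0 \<noteq> 0"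
    using irreducible_coeff_0_nonzero[OF irr pz] z \<open>expansion Q\<close> by (force simp: expansion_def)
  ultimately show ?thesis
    using exists_additive_eigenfunctional[OF irr _ p\<beta> _ \<open>x \<noteq> 0\<close>] that by blast
qed

section \<open>Tiles and substitution digits\<close>

lemma fst_tr: "fst (tr T x) = (+) x ` fst T"
  by (simp add: tr_def add.commute)

lemma tr_tr [simp]: "tr (tr T a) b = tr T (a + b)"
  by (simp add: tr_def image_image add.assoc)

lemma tr_0 [simp]: "tr T 0 = T"
  by (simp add: tr_def)

lemma translation_invariant_compact_imp_0:
  fixes S :: "'a::real_inner set"
  assumes "compact S" "S \<noteq> {}" "(+) d ` S = S"
  shows "d = 0"
proof -
  have "continuous_on S (\<lambda>v. v \<bullet> d)"
    by (intro continuous_intros)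
  then obtain s where s: "s \<in> S" "\<And>t. t \<in> S \<Longrightarrow> t \<bullet> d \<le> s \<bullet> d"
    using continuous_attains_sup[OF assms(1,2)] by blast
  have "d + s \<in> S"
    using s(1) assms(3) by blast
  then have "d \<bullet> d \<le> 0"
    using s(2) by (fastforce simp: inner_add_left)
  then show ?thesis
    by (metis inner_eq_zero_iff inner_ge_zero order_antisym)
qed

lemma inj_tr:
  assumes "is_tile P"
  shows "inj (tr P)"
proof (rule injI)
  fix a b assume "tr P a = tr P b"
  then have "(+) (- b) ` (+) a ` fst P = (+) (- b) ` (+) b ` fst P"
    by (simp add: fst_tr[symmetric])
  moreover have "(+) (a - b) = (+) (- b) \<circ> (+) a" "(+) (- b) \<circ> (+) b = id"
    by (auto simp: fun_eq_iff)
  ultimately have "(+) (a - b) ` fst P = fst P"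
    by (simp add: image_comp)
  with assms have "a - b = 0"
    by (intro translation_invariant_compact_imp_0) (auto simp: is_tile_def)
  then show "a = b"
    by simp
qed

text \<open>Translates of a tile inside a patch have disjoint interiors, so their translation
  vectors are uniformly discrete.\<close>
lemma finite_tile_positions:
  assumes patch: "is_patch \<T>" and tile: "is_tile P"
  shows "finite {y. tr P y \<in> \<T> \<and> norm y \<le> R}"
proof -
  have "interior (fst P) \<noteq> {}"
    using tile by (auto simp: is_tile_def)
  then obtain c e where e: "e > 0" "ball c e \<subseteq> interior (fst P)"
    by (meson all_not_in_conv open_contains_ball open_interior)
  have "y = y'" if "tr P y \<in> \<T>" "tr P y' \<in> \<T>" "dist y y' < e" for y y'
  proof (rule ccontr)
    assume "y \<noteq> y'"
    then have "tr P y \<noteq> tr P y'"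
      using inj_tr[OF tile] by (auto dest: injD)
    moreover have "c + y \<in> interior (fst (tr P y)) \<inter> interior (fst (tr P y'))"
    proof -
      have "dist c (c + y - y') < e"
        using that(3) by (simp add: dist_norm norm_minus_commute)
      then have "c \<in> interior (fst P)" "c + y - y' \<in> interior (fst P)"
        using e by auto
      moreover have "c + y = y + c" "c + y = y' + (c + y - y')"
        by (simp_all add: algebra_simps)
      ultimately show ?thesis
        unfolding fst_tr interior_translation by (metis IntI image_eqI)
    qed
    ultimately show False
      using patch that(1,2) unfolding is_patch_def by (metis empty_iff)
  qed
  then have "uniform_discrete {y. tr P y \<in> \<T> \<and> norm y \<le> R}"
    unfolding uniform_discrete_def using e(1) by blast
  moreover have "bounded {y. tr P y \<in> \<T> \<and> norm y \<le> R}"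
    by (rule bounded_subset[of "cball 0 R"]) auto
  ultimately show ?thesis
    using uniform_discrete_finite_iff by blast
qed

definition subst_digits ::
    "('n::finite, 'l) tile set \<Rightarrow> (('n, 'l) tile \<Rightarrow> ('n, 'l) tile set) \<Rightarrow> (real^'n) set" where
  "subst_digits A \<omega> = {t. \<exists>P\<in>A. \<exists>P'\<in>A. tr P t \<in> \<omega> P'}"

lemma finite_subst_digits:
  assumes "subst_rule A Q \<omega>"
  shows "finite (subst_digits A \<omega>)"
proof -
  have "subst_digits A \<omega> = (\<Union>P\<in>A. \<Union>P'\<in>A. tr P -` \<omega> P')"
    unfolding subst_digits_def by blast
  also have "finite \<dots>"
    using assms unfolding subst_rule_def by (auto intro!: finite_vimageI inj_tr)
  finally show ?thesis .
qed

lemma tile_has_parent: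
  assumes rule: "subst_rule A Q \<omega>" and sat: "self_affine_tiling A Q \<omega> \<T>"
    and P: "P \<in> A" "tr P y \<in> \<T>" and a: "a \<in> fst (tr P y)"
  obtains P' y' a' where "P' \<in> A" "tr P' y' \<in> \<T>" "a' \<in> fst (tr P' y')"
    "y - Q *v y' \<in> subst_digits A \<omega>" "a = Q *v a'"
proof -
  have cover: "\<And>T. T \<in> \<T> \<Longrightarrow> \<exists>P\<in>A. \<exists>y. T = tr P y"
    and fixpoint: "omega_patch \<omega> \<T> = \<T>"
    using sat by (simp_all add: self_affine_tiling_def)
  have omega_tr: "\<And>P x. P \<in> A \<Longrightarrow> \<omega> (tr P x) = tr_patch (\<omega> P) (Q *v x)"
    and omega_supp: "\<And>P. P \<in> A \<Longrightarrow> supp (\<omega> P) = (\<lambda>v. Q *v v) ` fst P"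
    using rule by (simp_all add: subst_rule_def)
  obtain T' where "T' \<in> \<T>" "tr P y \<in> \<omega> T'"
    using P(2) fixpoint unfolding omega_patch_def by blast
  moreover obtain P' y' where P': "P' \<in> A" "T' = tr P' y'"
    using cover \<open>T' \<in> \<T>\<close> by blast
  ultimately obtain S where S: "tr P' y' \<in> \<T>" "S \<in> \<omega> P'" "tr P y = tr S (Q *v y')"
    using omega_tr[OF P'(1)] unfolding tr_patch_def by auto
  have "tr P (y - Q *v y') = S"
    using arg_cong[OF S(3), of "\<lambda>T. tr T (- (Q *v y'))"] by simp
  then have digit: "y - Q *v y' \<in> subst_digits A \<omega>"
    unfolding subst_digits_def using P(1) P'(1) S(2) by blast
  obtain b where b: "b \<in> fst S" "a = Q *v y' + b"
    using a unfolding S(3) fst_tr by blast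
  have "fst S \<subseteq> (\<Union>T\<in>\<omega> P'. fst T)"
    using S(2) by blast
  then have "b \<in> (*v) Q ` fst P'"
    using b(1) closure_subset omega_supp[OF P'(1)] unfolding supp_def by blast
  then obtain c where c: "c \<in> fst P'" "b = Q *v c"
    by blast
  have "y' + c \<in> fst (tr P' y')"
    using c(1) by (simp add: fst_tr)
  moreover have "a = Q *v (y' + c)"
    by (simp add: b(2) c(2) matrix_vector_right_distrib)
  ultimately show ?thesis
    using that P'(1) S(1) digit by blast
qed

section \<open>Digit expansions of tile positions\<close>

lemma norm_le_digit_expansion_bound:
  fixes \<psi> :: "'a::ab_group_add \<Rightarrow> 'b::real_normed_field"
  assumes "Modules.additive \<psi>" and eqv: "\<And>v. \<psi> (f v) = \<beta> * \<psi> v" and "norm \<beta> < 1"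
    and "finite Dg" "finite F"
    and digit: "\<And>j. y j - f (y (Suc j)) \<in> Dg" and "y n \<in> F"
  shows "norm (\<psi> (y 0)) \<le> (\<Sum>v\<in>F. norm (\<psi> v)) + (\<Sum>t\<in>Dg. norm (\<psi> t)) / (1 - norm \<beta>)"
proof -
  define t where "t j = y j - f (y (Suc j))" for j
  have expansion: "\<psi> (y 0) = \<beta> ^ n * \<psi> (y n) + (\<Sum>j<n. \<beta> ^ j * \<psi> (t j))" for n
  proof (induction n)
    case (Suc n)
    have "\<psi> (y n) = \<psi> (t n) + \<beta> * \<psi> (y (Suc n))"
      using additive.add[OF \<open>Modules.additive \<psi>\<close>, of "t n" "f (y (Suc n))"] by (simp add: t_def eqv)
    with Suc show ?case
      by (simp add: algebra_simps)
  qed simp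
  have "norm (\<beta> ^ n * \<psi> (y n)) \<le> (\<Sum>v\<in>F. norm (\<psi> v))"
  proof -
    have "norm (\<beta> ^ n) \<le> 1"
      using \<open>norm \<beta> < 1\<close> by (simp add: norm_power power_le_one)
    moreover have "norm (\<psi> (y n)) \<le> (\<Sum>v\<in>F. norm (\<psi> v))"
      using \<open>finite F\<close> \<open>y n \<in> F\<close> by (intro member_le_sum) auto
    ultimately show ?thesis
      using mult_mono[of "norm (\<beta> ^ n)" 1 "norm (\<psi> (y n))"] by (simp add: norm_mult)
  qed
  moreover have "norm (\<Sum>j<n. \<beta> ^ j * \<psi> (t j)) \<le> (\<Sum>t\<in>Dg. norm (\<psi> t)) / (1 - norm \<beta>)"
  proof -
    let ?M = "\<Sum>t\<in>Dg. norm (\<psi> t)"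
    have "norm (\<Sum>j<n. \<beta> ^ j * \<psi> (t j)) \<le> (\<Sum>j<n. norm \<beta> ^ j * ?M)"
    proof (intro order_trans[OF norm_sum sum_mono])
      fix j
      have "norm (\<psi> (t j)) \<le> ?M"
        using \<open>finite Dg\<close> digit unfolding t_def by (intro member_le_sum) auto
      then show "norm (\<beta> ^ j * \<psi> (t j)) \<le> norm \<beta> ^ j * ?M"
        by (simp add: norm_mult norm_power mult_left_mono)
    qed
    also have "\<dots> = (1 - norm \<beta> ^ n) / (1 - norm \<beta>) * ?M"
      using \<open>norm \<beta> < 1\<close> by (simp add: sum_distrib_right[symmetric] sum_gp_strict)
    also have "\<dots> \<le> ?M / (1 - norm \<beta>)"
    proof -
      have "(1 - norm \<beta> ^ n) * ?M \<le> ?M"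
        by (simp add: algebra_simps sum_nonneg)
      then show ?thesis
        using \<open>norm \<beta> < 1\<close> by (simp add: divide_right_mono)
    qed
    finally show ?thesis .
  qed
  moreover have "norm (\<psi> (y 0)) \<le> norm (\<beta> ^ n * \<psi> (y n)) + norm (\<Sum>j<n. \<beta> ^ j * \<psi> (t j))"
    unfolding expansion[of n] by (rule norm_triangle_ineq)
  ultimately show ?thesis
    by linarith
qed

lemma ancestor_sequence:
  assumes rule: "subst_rule A Q \<omega>" and sat: "self_affine_tiling A Q \<omega> \<T>"
    and "P \<in> A" "tr P y \<in> \<T>" "a \<in> fst (tr P y)"
  obtains ys as where "ys 0 = y"
    "\<And>n. \<exists>P\<in>A. tr P (ys n) \<in> \<T> \<and> as n \<in> fst (tr P (ys n))"
    "\<And>n. ys n - Q *v ys (Suc n) \<in> subst_digits A \<omega>" "\<And>n. as n = Q *v as (Suc n)"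
proof -
  let ?tile_point = "\<lambda>s. \<exists>P\<in>A. tr P (fst s) \<in> \<T> \<and> snd s \<in> fst (tr P (fst s))"
  let ?parent = "\<lambda>s s'. fst s - Q *v fst s' \<in> subst_digits A \<omega> \<and> snd s = Q *v snd s'"
  have "\<exists>s. \<forall>n. (?tile_point (s n) \<and> (n = 0 \<longrightarrow> s n = (y, a))) \<and> ?parent (s n) (s (Suc n))"
  proof (rule dependent_nat_choice)
    show "\<exists>s. ?tile_point s \<and> (0 = 0 \<longrightarrow> s = (y, a))"
      using assms(3-5) by auto
    fix s and n :: nat
    assume "?tile_point s \<and> (n = 0 \<longrightarrow> s = (y, a))"
    then obtain P' where "P' \<in> A" "tr P' (fst s) \<in> \<T>" "snd s \<in> fst (tr P' (fst s))"
      by blast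
    then obtain P'' y'' a'' where "P'' \<in> A" "tr P'' y'' \<in> \<T>" "a'' \<in> fst (tr P'' y'')"
      "fst s - Q *v y'' \<in> subst_digits A \<omega>" "snd s = Q *v a''"
      by (rule tile_has_parent[OF rule sat])
    then show "\<exists>s'. (?tile_point s' \<and> (Suc n = 0 \<longrightarrow> s' = (y, a))) \<and> ?parent s s'"
      by (intro exI[of _ "(y'', a'')"]) auto
  qed
  then obtain s where s: "\<And>n. ?tile_point (s n)" "s 0 = (y, a)" "\<And>n. ?parent (s n) (s (Suc n))"
    by blast
  show ?thesis
  proof (rule that[of "\<lambda>n. fst (s n)" "\<lambda>n. snd (s n)"])
    show "fst (s 0) = y"
      using s(2) by simp
    show "\<exists>P\<in>A. tr P (fst (s n)) \<in> \<T> \<and> snd (s n) \<in> fst (tr P (fst (s n)))" for n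
      by (rule s(1))
    show "fst (s n) - Q *v fst (s (Suc n)) \<in> subst_digits A \<omega>" for n
      using s(3) by blast
    show "snd (s n) = Q *v snd (s (Suc n))" for n
      using s(3) by blast
  qed
qed

lemma additive_eigenfunctional_bounded_on_tiles:
  fixes \<psi> :: "real^'n::finite \<Rightarrow> 'b::real_normed_field"
  assumes rule: "subst_rule A Q \<omega>" and sat: "self_affine_tiling A Q \<omega> \<T>"
    and orbit_tendsto_0: "\<And>a. (\<And>n. Q *v a (Suc n) = a n) \<Longrightarrow> a \<longlonglongrightarrow> 0"
    and \<psi>: "Modules.additive \<psi>" "\<And>v. \<psi> (Q *v v) = \<beta> * \<psi> v" "norm \<beta> < 1"
  obtains B where "\<And>P y. P \<in> A \<Longrightarrow> tr P y \<in> \<T> \<Longrightarrow> norm (\<psi> y) \<le> B"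
proof -
  have "finite A" and tiles: "\<And>P. P \<in> A \<Longrightarrow> is_tile P"
    using rule by (simp_all add: subst_rule_def)
  then have "bounded (\<Union>P\<in>A. fst P)"
    by (auto simp: is_tile_def compact_imp_bounded)
  then obtain R where R: "\<And>P v. P \<in> A \<Longrightarrow> v \<in> fst P \<Longrightarrow> norm v \<le> R"
    unfolding bounded_iff by blast
  define F where "F = (\<Union>P\<in>A. {y. tr P y \<in> \<T> \<and> norm y \<le> R + 1})"
  have "finite F"
    using \<open>finite A\<close> tiles sat unfolding F_def self_affine_tiling_def is_tiling_def
    by (auto intro: finite_tile_positions)
  show ?thesis
  proof (rule that)
    fix P y assume P: "P \<in> A" "tr P y \<in> \<T>"
    obtain a where "a \<in> fst (tr P y)"
      using tiles[OF P(1)] by (auto simp: is_tile_def fst_tr)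
    then obtain ys as where chain: "ys 0 = y"
      "\<And>n. \<exists>P\<in>A. tr P (ys n) \<in> \<T> \<and> as n \<in> fst (tr P (ys n))"
      "\<And>n. ys n - Q *v ys (Suc n) \<in> subst_digits A \<omega>" "\<And>n. as n = Q *v as (Suc n)"
      using ancestor_sequence[OF rule sat P] by blast
    \<comment> \<open>The ancestors of a point of the tile tend to 0 and stay within \<open>R\<close> of the
      ancestor positions, so these eventually lie in the finite set \<open>F\<close>.\<close>
    have "as \<longlonglongrightarrow> 0"
      using orbit_tendsto_0 chain(4) by metis
    then have "eventually (\<lambda>n. norm (as n) < 1) sequentially"
      by (rule order_tendstoD(2)[OF tendsto_norm_zero]) simp
    then obtain n where "norm (as n) < 1"
      unfolding eventually_sequentially by blast
    obtain P' where P': "P' \<in> A" "tr P' (ys n) \<in> \<T>" "as n - ys n \<in> fst P'"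
      using chain(2)[of n] by (auto simp: fst_tr)
    have "norm (as n - ys n) \<le> R"
      using R P'(1,3) by blast
    then have "norm (ys n) \<le> R + 1"
      using \<open>norm (as n) < 1\<close> norm_triangle_ineq4[of "as n" "as n - ys n"] by simp
    then have "ys n \<in> F"
      unfolding F_def using P'(1,2) by blast
    then show "norm (\<psi> y) \<le> (\<Sum>v\<in>F. norm (\<psi> v)) + (\<Sum>t\<in>subst_digits A \<omega>. norm (\<psi> t)) / (1 - norm \<beta>)"
      using norm_le_digit_expansion_bound[where \<psi>=\<psi> and f="(*v) Q" and \<beta>=\<beta> and y=ys,
          OF \<psi> finite_subst_digits[OF rule] \<open>finite F\<close> chain(3)]
      by (simp add: chain(1))
  qed
qed

lemma no_return_beyond:
  fixes \<psi> :: "real^'n::finite \<Rightarrow> 'b::real_normed_field"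
  assumes cover: "\<And>T. T \<in> \<T> \<Longrightarrow> \<exists>P\<in>A. \<exists>y. T = tr P y" and "Modules.additive \<psi>"
    and bound: "\<And>P y. P \<in> A \<Longrightarrow> tr P y \<in> \<T> \<Longrightarrow> norm (\<psi> y) \<le> B" and "\<psi> x \<noteq> 0"
  shows "\<exists>n0::nat. \<forall>n>n0. \<forall>T\<in>\<T>. tr T (real n *\<^sub>R x) \<notin> \<T>"
proof (intro exI allI impI ballI notI)
  fix n T assume n: "n > nat \<lceil>2 * B / norm (\<psi> x)\<rceil>" and "T \<in> \<T>" "tr T (real n *\<^sub>R x) \<in> \<T>"
  obtain P y where "P \<in> A" "T = tr P y"
    using cover \<open>T \<in> \<T>\<close> by blast
  then have "norm (\<psi> y) \<le> B" "norm (\<psi> (y + real n *\<^sub>R x)) \<le> B"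
    using bound \<open>T \<in> \<T>\<close> \<open>tr T (real n *\<^sub>R x) \<in> \<T>\<close> by auto
  moreover have "\<psi> (y + real n *\<^sub>R x) = \<psi> y + of_nat n * \<psi> x"
    using additive.sum[OF \<open>Modules.additive \<psi>\<close>, of "\<lambda>_. x" "{..<n}"]
    by (simp add: additive.add[OF \<open>Modules.additive \<psi>\<close>] scaleR_conv_of_real)
  ultimately have "real n * norm (\<psi> x) \<le> 2 * B"
    using norm_triangle_ineq4[of "\<psi> (y + real n *\<^sub>R x)" "\<psi> y"] by (simp add: norm_mult)
  then have "real n \<le> 2 * B / norm (\<psi> x)"
    using \<open>\<psi> x \<noteq> 0\<close> by (simp add: field_simps)
  with n show False
    by linarith
qed

lemma not_legal_if_no_return_beyond:
  assumes "\<forall>n>n0. \<forall>T\<in>\<T>. tr T (real n *\<^sub>R x) \<notin> \<T>"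
  shows "\<not> legal \<T> {tr T (real k *\<^sub>R x) | k. 1 \<le> k \<and> k \<le> n0 + 2}"
proof
  assume "legal \<T> {tr T (real k *\<^sub>R x) | k. 1 \<le> k \<and> k \<le> n0 + 2}"
  then obtain z where "tr_patch {tr T (real k *\<^sub>R x) | k. 1 \<le> k \<and> k \<le> n0 + 2} z \<subseteq> \<T>"
    unfolding legal_def by blast
  then have "tr (tr T (real k *\<^sub>R x)) z \<in> \<T>" if "1 \<le> k" "k \<le> n0 + 2" for k
    using that unfolding tr_patch_def by blast
  from this[of 1] this[of "n0 + 2"] have "tr T (x + z) \<in> \<T>" "tr (tr T (x + z)) (real (n0 + 1) *\<^sub>R x) \<in> \<T>"
    by (simp_all add: scaleR_add_left scaleR_2 add_ac)
  then show False
    using assms[rule_format, of "n0 + 1" "tr T (x + z)"] by simp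
qed

theorem theorem3p6:
  fixes A :: "('n::finite, 'l) tile set"
    and Q :: "real^'n^'n"
    and \<omega> :: "('n, 'l) tile \<Rightarrow> ('n, 'l) tile set"
    and \<T> :: "('n, 'l) tile set"
    and J :: nat
  assumes rule: "subst_rule A Q \<omega>"
    and prim: "primitive A \<omega>"
    and flc: "subst_FLC A \<omega>"
    and sat: "self_affine_tiling A Q \<omega> \<T>"
    and diag: "diagonalizable_C Q"
    and conj: "\<forall>z \<mu>. eigenvalue Q z \<and> eigenvalue Q \<mu> \<longrightarrow> alg_conj z \<mu>"
    and mult: "\<forall>z. eigenvalue Q z \<longrightarrow> eig_mult Q z = J"
    and beta: "\<exists>z \<beta>. eigenvalue Q z \<and> alg_conj z \<beta> \<and> cmod \<beta> < 1"
  shows "\<forall>x. return_vector \<T> x \<and> x \<noteq> 0 \<longrightarrow>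
           (\<exists>n0::nat. \<forall>n>n0. \<forall>T\<in>\<T>. tr T (real n *\<^sub>R x) \<notin> \<T>) \<and>
           (\<forall>T\<in>\<T>. \<exists>n0::nat. n0 > 0 \<and>
               \<not> legal \<T> {tr T (real k *\<^sub>R x) | k. 1 \<le> k \<and> k \<le> n0})"
proof (intro allI impI conjI)
  fix x assume "return_vector \<T> x \<and> x \<noteq> 0"
  then have "x \<noteq> 0" ..
  have "expansion Q" and cover: "\<And>T. T \<in> \<T> \<Longrightarrow> \<exists>P\<in>A. \<exists>y. T = tr P y"
    using rule sat by (simp_all add: subst_rule_def self_affine_tiling_def)
  obtain z \<beta> where "eigenvalue Q z" "alg_conj z \<beta>" "cmod \<beta> < 1"
    using beta by blast
  then obtain \<psi> where \<psi>: "Modules.additive \<psi>" "\<And>v. \<psi> (Q *v v) = \<beta> * \<psi> v" "\<psi> x \<noteq> 0"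
    using exists_conjugate_eigenfunctional[OF diag \<open>expansion Q\<close> conj _ _ \<open>x \<noteq> 0\<close>] by blast
  obtain B where "\<And>P y. P \<in> A \<Longrightarrow> tr P y \<in> \<T> \<Longrightarrow> cmod (\<psi> y) \<le> B"
    using additive_eigenfunctional_bounded_on_tiles[where \<psi>=\<psi>, OF rule sat
        backward_orbit_tendsto_0[OF diag \<open>expansion Q\<close>] \<psi>(1,2) \<open>cmod \<beta> < 1\<close>] by blast
  then obtain n0 where n0: "\<forall>n>n0. \<forall>T\<in>\<T>. tr T (real n *\<^sub>R x) \<notin> \<T>"
    using no_return_beyond[OF cover \<psi>(1) _ \<psi>(3)] by blast
  then show "\<exists>n0::nat. \<forall>n>n0. \<forall>T\<in>\<T>. tr T (real n *\<^sub>R x) \<notin> \<T>"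
    by blast
  show "\<forall>T\<in>\<T>. \<exists>n0::nat. n0 > 0 \<and> \<not> legal \<T> {tr T (real k *\<^sub>R x) | k. 1 \<le> k \<and> k \<le> n0}"
    using not_legal_if_no_return_beyond[OF n0] by (intro ballI exI[of _ "n0 + 2"]) simp
qed

end
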